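(* Let $k\ge 1$ be an integer, and let $G,H\in\mathbb{F}_q[x]$ with $H\neq 0$. Let $A$ be the monic polynomial with $A^k=(G,H^k)_k$ and put $N=H/A$ (so $N^k=H^k/(G,H^k)_k$). Then $$\eta_k(G,H)=\phi_k(H)\,\mu(N)\,\phi_k(N)^{-1}.$$
   Context: Let $\mathbb{F}_q$ be a finite field with $q$ elements and fix a non-trivial homomorphism $\lambda:(\mathbb{F}_q,+)\to\mathbb{C}^*$. For nonzero $M\in\mathbb{F}_q[x]$ of degree $m\ge1$ and $A\in\mathbb{F}_q[x]$, let $t_M(A)\in\mathbb{F}_q$ be the coefficient of $x^{m-1}$ in the remainder of $A$ on division by $M$ (if $m=0$, $t_M(A)=0$). For $G\in\mathbb{F}_q[x]$ define $E(G,M):\mathbb{F}_q[x]\to\mathbb{C}$ by $E(G,M)(A)=\lambda(t_M(GA))$. For an integer $k\ge1$ and $A,B\in\mathbb{F}_q[x]$ not both zero, $(A,B)_k$ is the monic polynomial of the form $C^k$ of largest degree with $C^k\mid A$ and $C^k\mid B$; $(A,B)_1=(A,B)$ is the monic gcd. For nonzero $H$, $\eta_k(G,H)=\sum_{D}E(G,H^k)(D)$, where $D$ runs over a complete residue system modulo $H^k$ subject to $(D,H^k)_k=1$. $|A|=q^{\deg A}$. The Möbius function: $\mu(0)=0$; for $A\ne0$, $\mu(A)=0$ if $P^2\mid A$ for some irreducible $P$, and otherwise $\mu(A)=(-1)^t$ where $t$ is the number of distinct monic irreducible factors of $A$ (so $\mu(c)=1$ for nonzero constants $c$). The Jordan totient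 function is $\phi_k(H)=|H|^k\prod_{P}(1-|P|^{-k})$ for $H\neq0$, the product over monic irreducible $P$ dividing $H$. *)

theory Defs
  imports
    Complex_Main
    "HOL-Computational_Algebra.Polynomial"
    "HOL-Number_Theory.Cong"
begin

text \<open>
  Throughout, the finite field with \<open>q\<close> elements is a type \<open>'a :: {field, finite}\<close>, so that
  \<open>q = CARD('a)\<close>.
\<close>

definition nontrivial_additive_character :: "('a::{field,finite} \<Rightarrow> complex) \<Rightarrow> bool" where
  "nontrivial_additive_character lam \<longleftrightarrow>
     (\<forall>a. lam a \<noteq> 0) \<and> (\<forall>a b. lam (a + b) = lam a * lam b) \<and> (\<exists>a. lam a \<noteq> 1)"

definition t_coeff :: "'a::{field,finite} poly \<Rightarrow> 'a poly \<Rightarrow> 'a" where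
  "t_coeff M A = (if degree M = 0 then 0 else coeff (A mod M) (degree M - 1))"

definition E_char ::
  "('a::{field,finite} \<Rightarrow> complex) \<Rightarrow> 'a poly \<Rightarrow> 'a poly \<Rightarrow> 'a poly \<Rightarrow> complex" where
  "E_char lam G M A = lam (t_coeff M (G * A))"

definition monic_common_kth_power ::
  "nat \<Rightarrow> 'a::{field,finite} poly \<Rightarrow> 'a poly \<Rightarrow> 'a poly \<Rightarrow> bool" where
  "monic_common_kth_power k A B D \<longleftrightarrow>
     lead_coeff D = 1 \<and> (\<exists>C. D = C ^ k) \<and> D dvd A \<and> D dvd B"

text \<open>Meaningful only for \<open>k \<ge> 1\<close> and \<open>A\<close>, \<open>B\<close> not both zero; see \<open>kgcd_unique\<close> below.\<close>

definition kgcd :: "nat \<Rightarrow> 'a::{field,finite} poly \<Rightarrow> 'a poly \<Rightarrow> 'a poly" where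
  "kgcd k A B =
     (THE D. monic_common_kth_power k A B D \<and>
        (\<forall>D'. monic_common_kth_power k A B D' \<longrightarrow> degree D' \<le> degree D))"

definition complete_residue_system ::
  "'a::{field,finite} poly \<Rightarrow> 'a poly set \<Rightarrow> bool" where
  "complete_residue_system M R \<longleftrightarrow> (\<forall>A. \<exists>!D. D \<in> R \<and> [A = D] (mod M))"

text \<open>The complete residue system \<open>R\<close> modulo \<open>H ^ k\<close> is an explicit argument.\<close>

definition eta ::
  "('a::{field,finite} \<Rightarrow> complex) \<Rightarrow> nat \<Rightarrow> 'a poly set \<Rightarrow> 'a poly \<Rightarrow> 'a poly \<Rightarrow> complex" where
  "eta lam k R G H = (\<Sum>D | D \<in> R \<and> kgcd k D (H ^ k) = 1. E_char lam G (H ^ k) D)"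

text \<open>\<open>pnorm A\<close> is \<open>|A|\<close>; it is only ever used for \<open>A \<noteq> 0\<close>.\<close>

definition pnorm :: "'a::{field,finite} poly \<Rightarrow> real" where
  "pnorm A = real (card (UNIV :: 'a set)) ^ degree A"

definition monic_irreducible_factors :: "'a::{field,finite} poly \<Rightarrow> 'a poly set" where
  "monic_irreducible_factors A = {P. lead_coeff P = 1 \<and> irreducible P \<and> P dvd A}"

definition poly_mu :: "'a::{field,finite} poly \<Rightarrow> int" where
  "poly_mu A =
     (if A = 0 then 0
      else if \<exists>P. irreducible P \<and> P\<^sup>2 dvd A then 0
      else (-1) ^ card (monic_irreducible_factors A))"

definition jordan_phi :: "nat \<Rightarrow> 'a::{field,finite} poly \<Rightarrow> real" where
  "jordan_phi k H =
     pnorm H ^ k * (\<Prod>P \<in> monic_irreducible_factors H. 1 - 1 / pnorm P ^ k)"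


subsection \<open>Well-definedness of \<open>kgcd\<close> and of its monic \<open>k\<close>-th root\<close>

lemma poly_bezout_cofactors:
  fixes A B :: "'a::field poly"
  assumes "A \<noteq> 0 \<or> B \<noteq> 0"
  shows "\<exists>g a b u v. g \<noteq> 0 \<and> A = g * a \<and> B = g * b \<and> u * a + v * b = 1"
  using assms
proof (induction "if B = 0 then 0 else Suc (degree B)" arbitrary: A B rule: less_induct)
  case less
  show ?case
  proof (cases "B = 0")
    case True
    then show ?thesis using less.prems
      by (intro exI[of _ A] exI[of _ 1] exI[of _ 0] exI[of _ 1] exI[of _ 0]) auto
  next
    case False
    define r where "r = A mod B"
    have "(if r = 0 then 0 else Suc (degree r)) < (if B = 0 then 0 else Suc (degree B))"
      using degree_mod_less[OF False, of A] False by (auto simp: r_def)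
    from less.hyps[OF this, of B] False obtain g a b u v where
      *: "g \<noteq> 0" "B = g * a" "r = g * b" "u * a + v * b = 1" by auto
    have A: "A = (A div B) * B + r" by (simp add: r_def)
    have "A = g * ((A div B) * a + b)"
      using A *(2,3) by (metis distrib_left mult.left_commute)
    moreover have "v * ((A div B) * a + b) + (u - v * (A div B)) * a = 1"
      using *(4) by (simp add: algebra_simps)
    ultimately show ?thesis using * by blast
  qed
qed

lemma comaximal_power:
  fixes a b :: "'a::comm_ring_1"
  assumes "u * a + v * b = 1"
  shows "\<exists>u v. u * a + v * b ^ n = 1"
proof (induction n)
  case 0
  show ?case by (intro exI[of _ 0] exI[of _ 1]) auto
next
  case (Suc n)
  then obtain x y where xy: "x * a + y * b ^ n = 1" by blast
  have "(u * a + v * b) * (x * a + y * b ^ n) = 1" using assms xy by simp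
  then have "(u * x * a + u * y * b ^ n + v * b * x) * a + (v * y) * b ^ Suc n = 1"
    by (simp add: algebra_simps)
  then show ?case by blast
qed

lemma comaximal_powers:
  fixes a b :: "'a::comm_ring_1"
  assumes "u * a + v * b = 1"
  shows "\<exists>u v. u * a ^ m + v * b ^ n = 1"
proof -
  from comaximal_power[OF assms] obtain x y where "x * a + y * b ^ n = 1" by blast
  then have "y * b ^ n + x * a = 1" by (simp add: add.commute)
  from comaximal_power[OF this] obtain x' y' where "x' * b ^ n + y' * a ^ m = 1" by blast
  then have "y' * a ^ m + x' * b ^ n = 1" by (simp add: add.commute)
  then show ?thesis by blast
qed

lemma comaximal_mult_dvd:
  fixes a b c :: "'a::comm_ring_1"
  assumes "u * a + v * b = 1" "a dvd c" "b dvd c"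
  shows "a * b dvd c"
proof -
  from assms obtain x y where xy: "c = a * x" "c = b * y" by (metis dvdE)
  have "c = c * (u * a + v * b)" using assms by simp
  also have "\<dots> = u * a * c + v * b * c" by (simp add: algebra_simps)
  also have "\<dots> = u * a * (b * y) + v * b * (a * x)" using xy by simp
  also have "\<dots> = (a * b) * (u * y + v * x)" by (simp add: algebra_simps)
  finally show ?thesis by simp
qed

lemma poly_power_dvd_power_imp_dvd:
  fixes A B :: "'a::field poly"
  assumes "A ^ k dvd B ^ k" "k \<ge> 1"
  shows "A dvd B"
proof (cases "A = 0 \<and> B = 0")
  case False
  then obtain g a b u v where *: "g \<noteq> 0" "A = g * a" "B = g * b" "u * a + v * b = 1"
    using poly_bezout_cofactors[of A B] by metis
  have "a ^ k dvd b ^ k"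
    using assms(1) *(1) unfolding *(2,3) by (simp add: power_mult_distrib)
  moreover have "a dvd a ^ k" using assms(2) by (simp add: dvd_power)
  ultimately have d: "a dvd b ^ k" by (rule dvd_trans[rotated])
  from comaximal_power[OF *(4)] obtain x y where "x * a + y * b ^ k = 1" by blast
  then have "a dvd 1" using d by (metis dvd_add dvd_mult dvd_refl)
  then have "a dvd b" by (rule dvd_trans) simp
  then show ?thesis unfolding *(2,3) by (rule mult_dvd_mono[OF dvd_refl])
qed simp

lemma monic_dvd_same_degree:
  fixes p q :: "'a::field poly"
  assumes "p dvd q" "degree q \<le> degree p" "lead_coeff p = 1" "lead_coeff q = 1"
  shows "p = q"
proof -
  from assms obtain r where r: "q = p * r" by auto
  have nz: "p \<noteq> 0" "r \<noteq> 0" using assms r by auto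
  then have "degree r = 0" using r assms(2) by (simp add: degree_mult_eq)
  moreover have "lead_coeff r = 1" using r assms(3,4) by (simp add: lead_coeff_mult)
  ultimately have "r = 1" by (auto elim!: degree_eq_zeroE simp: one_pCons)
  then show ?thesis using r by simp
qed

lemma kgcd_unique:
  fixes A B :: "'a::{field,finite} poly"
  assumes "A \<noteq> 0 \<or> B \<noteq> 0"
  shows "\<exists>!D. monic_common_kth_power k A B D \<and>
           (\<forall>D'. monic_common_kth_power k A B D' \<longrightarrow> degree D' \<le> degree D)"
proof (rule ex_ex1I)
  have "monic_common_kth_power k A B 1"
    by (auto simp: monic_common_kth_power_def intro!: exI[of _ 1])
  moreover have "degree D < Suc (degree A + degree B)" if "monic_common_kth_power k A B D" for D
    using that assms
    by (auto simp: monic_common_kth_power_def less_Suc_eq_le dest!: dvd_imp_degree_le)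
  ultimately show "\<exists>D. monic_common_kth_power k A B D \<and>
           (\<forall>D'. monic_common_kth_power k A B D' \<longrightarrow> degree D' \<le> degree D)"
    using Lattices_Big.ex_has_greatest_nat[of "monic_common_kth_power k A B" 1 degree]
    by blast
next
  fix D D'
  assume D: "monic_common_kth_power k A B D \<and>
           (\<forall>D'. monic_common_kth_power k A B D' \<longrightarrow> degree D' \<le> degree D)"
    and D': "monic_common_kth_power k A B D' \<and>
           (\<forall>D''. monic_common_kth_power k A B D'' \<longrightarrow> degree D'' \<le> degree D')"
  from D obtain C where C: "D = C ^ k" "lead_coeff D = 1" "D dvd A" "D dvd B"
    by (auto simp: monic_common_kth_power_def)
  from D' obtain C' where C': "D' = C' ^ k" "lead_coeff D' = 1" "D' dvd A" "D' dvd B"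
    by (auto simp: monic_common_kth_power_def)
  show "D = D'"
  proof (cases "k = 0")
    case True
    then show ?thesis using C C' by simp
  next
    case k: False
    have nz: "C \<noteq> 0" "C' \<noteq> 0" using C C' k by (auto simp: zero_power)
    then obtain g c c' u v where *: "g \<noteq> 0" "C = g * c" "C' = g * c'" "u * c + v * c' = 1"
      using poly_bezout_cofactors[of C C'] by metis
    from comaximal_powers[OF *(4)] obtain x y where xy: "x * c ^ k + y * c' ^ k = 1" by blast
    define L where "L = g * c * c'"
    have dvd: "L ^ k dvd F" if F: "D dvd F" "D' dvd F" for F
    proof -
      from F(1) C(1) *(2) have "g ^ k dvd F"
        by (metis dvd_mult_left power_mult_distrib)
      then obtain f where f: "F = g ^ k * f" by auto
      have "c ^ k dvd f" "c' ^ k dvd f"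
        using F *(1) unfolding C(1) C'(1) *(2,3) f by (simp_all add: power_mult_distrib)
      then have "c ^ k * c' ^ k dvd f" by (rule comaximal_mult_dvd[OF xy])
      then show ?thesis
        by (simp add: L_def f power_mult_distrib mult.assoc)
    qed
    have L0: "L \<noteq> 0" using nz * by (simp add: L_def)
    define K where "K = smult (inverse (lead_coeff L)) L"
    have K: "lead_coeff K = 1" "lead_coeff (K ^ k) = 1"
      using L0 by (simp_all add: K_def lead_coeff_power)
    have "K ^ k dvd A" "K ^ k dvd B"
      using dvd C C' L0 by (simp_all add: K_def smult_power smult_dvd_iff)
    then have cand: "monic_common_kth_power k A B (K ^ k)"
      using K by (auto simp: monic_common_kth_power_def)
    have "C dvd L" "C' dvd L" using * by (auto simp: L_def)
    then have "C dvd K" "C' dvd K" using L0 by (auto simp: K_def dvd_smult)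
    then have "D dvd K ^ k" "D' dvd K ^ k" using C C' by (simp_all add: dvd_power_same)
    moreover have "degree (K ^ k) \<le> degree D" "degree (K ^ k) \<le> degree D'"
      using cand D D' by blast+
    ultimately have "D = K ^ k" "D' = K ^ k"
      using C C' K monic_dvd_same_degree by blast+
    then show ?thesis by simp
  qed
qed

lemma kgcd_root_unique:
  fixes A B :: "'a::{field,finite} poly"
  assumes "A \<noteq> 0 \<or> B \<noteq> 0" "k \<ge> 1"
  shows "\<exists>!C. lead_coeff C = 1 \<and> C ^ k = kgcd k A B"
proof (rule ex_ex1I)
  have "monic_common_kth_power k A B (kgcd k A B)"
    using theI'[OF kgcd_unique[OF assms(1), of k]] unfolding kgcd_def by blast
  then obtain C where C: "kgcd k A B = C ^ k" "lead_coeff (C ^ k) = 1"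
    by (auto simp: monic_common_kth_power_def)
  have lc: "lead_coeff C ^ k = 1" using C by (simp add: lead_coeff_power)
  then have "C \<noteq> 0" using assms(2) by (auto simp: zero_power)
  then show "\<exists>C. lead_coeff C = 1 \<and> C ^ k = kgcd k A B"
    using lc C
    by (intro exI[of _ "smult (inverse (lead_coeff C)) C"])
      (simp add: smult_power power_inverse)
next
  fix C C'
  assume "lead_coeff C = 1 \<and> C ^ k = kgcd k A B" "lead_coeff C' = 1 \<and> C' ^ k = kgcd k A B"
  then have *: "lead_coeff C = 1" "lead_coeff C' = 1" "C dvd C'" "C' dvd C"
    using poly_power_dvd_power_imp_dvd[of C k C'] poly_power_dvd_power_imp_dvd[of C' k C] assms(2)
    by auto
  then have "C \<noteq> 0" by auto
  then show "C = C'" using * monic_dvd_same_degree dvd_imp_degree_le by blast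
qed

end

theory Submission
  imports Defs "HOL-Computational_Algebra.Polynomial_Factorial" "HOL-Library.Cardinality"
begin

text \<open>
  The condition on \<open>D\<close> says that no \<open>P ^ k\<close> with \<open>P\<close> a monic irreducible factor of \<open>H\<close> divides
  \<open>D\<close>. By inclusion-exclusion, \<open>eta\<close> is the sum of
  \<open>(-1) ^ card S * (\<Sum>D mod H ^ k, Q ^ k dvd D. E D)\<close> over the sets \<open>S\<close> of such factors, where
  \<open>Q = \<Prod>S\<close>. By orthogonality the inner sum is \<open>|H / Q| ^ k\<close> if \<open>(H / Q) ^ k\<close> divides \<open>G\<close>, and
  \<open>0\<close> otherwise. Since \<open>H = A * N\<close>, the condition \<open>(H / Q) ^ k dvd G\<close> means \<open>H / Q dvd A\<close>, i.e.
  \<open>N dvd Q\<close>. No \<open>S\<close> satisfies it if \<open>N\<close> is not squarefree; otherwise it says that \<open>S\<close> contains the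
  irreducible factors of \<open>N\<close>, and the sum over these \<open>S\<close> factors as an Euler product.
\<close>

section \<open>Monic irreducible factors and products of distinct ones\<close>

lemma irreducible_poly_comaximal:
  fixes P B :: "'a::field poly"
  assumes "irreducible P" "\<not> P dvd B"
  shows "\<exists>u v. u * P + v * B = 1"
proof -
  have "P \<noteq> 0" using assms(1) by auto
  then obtain g a b u v where *: "g \<noteq> 0" "P = g * a" "B = g * b" "u * a + v * b = 1"
    using poly_bezout_cofactors[of P B] by metis
  \<comment> \<open>Were \<open>a\<close> a unit, \<open>P\<close> would be associated to
    \<open>g\<close> and hence divide \<open>B\<close>.\<close>
  have "\<not> a dvd 1"
  proof
    assume "a dvd 1"
    then have "g * a dvd g" by (metis dvd_refl mult_dvd_mono mult.right_neutral)
    then show False using assms(2) * by (metis dvd_mult2)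
  qed
  then have "g dvd 1" using irreducibleD[OF assms(1) *(2)] by blast
  then obtain h where h: "1 = g * h" by (auto elim: dvdE)
  have "(u * h) * P + (v * h) * B = (g * h) * (u * a + v * b)"
    by (simp add: *(2,3) algebra_simps)
  then show ?thesis using h *(4) by (metis mult_1)
qed

lemma exists_monic_irreducible_factor:
  fixes p :: "'a::field poly"
  assumes "p \<noteq> 0" "\<not> p dvd 1"
  shows "\<exists>P. lead_coeff P = 1 \<and> irreducible P \<and> P dvd p"
  using assms
proof (induction "degree p" arbitrary: p rule: less_induct)
  case less
  show ?case
  proof (cases "irreducible p")
    case True
    define P where "P = smult (inverse (lead_coeff p)) p"
    have c: "inverse (lead_coeff p) \<noteq> 0" using less.prems by simp
    have "P = [:inverse (lead_coeff p):] * p" by (simp add: P_def)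
    moreover have "is_unit [:inverse (lead_coeff p):]" 
      using c by (simp add: is_unit_const_poly_iff dvd_field_iff)
    ultimately have "irreducible P" using True
      by (metis irreducible_mult_unit_left)
    moreover have "lead_coeff P = 1" using less.prems by (simp add: P_def)
    moreover have "P dvd p" using c by (simp add: P_def smult_dvd_iff)
    ultimately show ?thesis by blast
  next
    case False
    then obtain a b where ab: "p = a * b" "\<not> a dvd 1" "\<not> b dvd 1"
      using less.prems by (auto simp: irreducible_def)
    have nz: "a \<noteq> 0" "b \<noteq> 0" using ab less.prems by auto
    have "degree b \<noteq> 0" using ab(3) nz by (simp add: is_unit_iff_degree)
    then have "degree a < degree p" using ab(1) nz by (simp add: degree_mult_eq)
    from less.hyps[OF this nz(1) ab(2)] show ?thesis using ab(1) by (metis dvd_mult2)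
  qed
qed

lemma monic_irreducible_dvd_imp_eq:
  fixes P Q :: "'a::field poly"
  assumes "lead_coeff P = 1" "irreducible P" "lead_coeff Q = 1" "irreducible Q" "P dvd Q"
  shows "P = Q"
proof -
  obtain r where r: "Q = P * r" using assms(5) by auto
  then have "r dvd 1" using assms(2,4) irreducibleD[OF assms(4) r] by (auto simp: irreducible_def)
  then have "degree Q \<le> degree P" using r assms(3) degree_mult_le[of P r]
    by (cases "r = 0") (auto simp: is_unit_iff_degree)
  then show ?thesis using assms monic_dvd_same_degree by blast
qed

text \<open>Irreducible polynomials over a field are prime, so \<open>P\<close> divides some member
  of \<open>S\<close>; monic irreducibles of which one divides the other coincide.\<close>

lemma monic_irreducible_dvd_prod_iff:
  fixes S :: "'a::field poly set"
  assumes "finite S" "\<And>Q. Q \<in> S \<Longrightarrow> lead_coeff Q = 1 \<and> irreducible Q"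
    and "lead_coeff P = 1" "irreducible P"
  shows "P dvd \<Prod>S \<longleftrightarrow> P \<in> S"
proof
  assume "P dvd \<Prod>S"
  then obtain Q where "Q \<in> S" "P dvd Q"
    using prime_elem_dvd_prod_msetE[OF field_poly_irreducible_imp_prime[OF assms(4)], of "mset_set S"]
      assms(1) by (auto simp: prod_unfold_prod_mset)
  then show "P \<in> S" using monic_irreducible_dvd_imp_eq assms by metis
qed (use assms(1) in \<open>auto intro: dvd_prod_eqI\<close>)

text \<open>A new factor \<open>P\<close> is comaximal with the product of the others. This survives
  taking \<open>k\<close>-th powers, and comaximal divisors multiply. The conditions in
  inclusion-exclusion thereby become a single divisibility.\<close>

lemma prod_power_dvd_iff:
  fixes S :: "'a::field poly set"
  assumes "finite S" "\<And>Q. Q \<in> S \<Longrightarrow> lead_coeff Q = 1 \<and> irreducible Q"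
  shows "(\<Prod>S) ^ k dvd D \<longleftrightarrow> (\<forall>P\<in>S. P ^ k dvd D)"
  using assms
proof (induction S rule: finite_induct)
  case (insert P S)
  have IH: "(\<Prod>S) ^ k dvd D \<longleftrightarrow> (\<forall>P\<in>S. P ^ k dvd D)" using insert by auto
  have "\<not> P dvd \<Prod>S"
    using monic_irreducible_dvd_prod_iff[of S P] insert by auto
  then obtain u v where "u * P + v * \<Prod>S = 1"
    using irreducible_poly_comaximal[of P "\<Prod>S"] insert.prems by auto
  from comaximal_powers[OF this] obtain u v where uv: "u * P ^ k + v * (\<Prod>S) ^ k = 1" by blast
  have "P ^ k * (\<Prod>S) ^ k dvd D \<longleftrightarrow> P ^ k dvd D \<and> (\<Prod>S) ^ k dvd D"
    using comaximal_mult_dvd[OF uv] by (auto dest: dvd_mult_left dvd_mult_right)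
  then show ?case using insert IH by (simp add: power_mult_distrib)
qed auto

text \<open>Each irreducible occurs at most once in the product: after cancelling it, it would have
  to divide the product of the remaining members.\<close>

lemma square_not_dvd_prod:
  fixes S :: "'a::field poly set"
  assumes "finite S" "\<And>Q. Q \<in> S \<Longrightarrow> lead_coeff Q = 1 \<and> irreducible Q" "irreducible P"
  shows "\<not> P\<^sup>2 dvd \<Prod>S"
proof
  assume d: "P\<^sup>2 dvd \<Prod>S"
  \<comment> \<open>\<open>P\<close> need not be monic, while the members of \<open>S\<close> are,
    so a monic irreducible divisor takes its place.\<close>
  obtain P' where P': "lead_coeff P' = 1" "irreducible P'" "P' dvd P"
    using exists_monic_irreducible_factor[of P] assms(3) by (auto simp: irreducible_def)
  have d': "P'\<^sup>2 dvd \<Prod>S" using dvd_power_same[OF P'(3)] d dvd_trans by blast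
  then have "P' dvd \<Prod>S" by (simp add: power2_eq_square dvd_mult_left)
  then have "P' \<in> S" using monic_irreducible_dvd_prod_iff[OF assms(1,2) P'(1,2)] by simp
  then have "\<Prod>S = P' * \<Prod>(S - {P'})" using assms(1) by (simp add: prod.remove)
  moreover have "P' \<noteq> 0" using P'(2) by auto
  ultimately have "P' dvd \<Prod>(S - {P'})" using d' by (simp add: power2_eq_square)
  then show False
    using monic_irreducible_dvd_prod_iff[of "S - {P'}" P'] assms(1,2) P'(1,2) by auto
qed

section \<open>Remainders and residue systems\<close>

definition polys_below :: "nat \<Rightarrow> 'a::zero poly set" where
  "polys_below n = {p. \<forall>i\<ge>n. coeff p i = 0}"

text \<open>Membership by coefficients makes closure under sums immediate; this form serves degree
  arguments. Zero is a separate case because its \<open>degree\<close> is 0 by convention, yet it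
  lies below even \<open>n = 0\<close>.\<close>

lemma polys_below_iff: "p \<in> polys_below n \<longleftrightarrow> p = 0 \<or> degree p < n"
proof -
  have "p = 0 \<or> degree p < n" if "\<forall>i\<ge>n. coeff p i = 0"
    using that by (metis leading_coeff_0_iff not_less)
  then show ?thesis by (auto simp: polys_below_def coeff_eq_0)
qed

lemma card_polys_below:
  "finite (polys_below n :: 'a::{zero,finite} poly set) \<and>
   card (polys_below n :: 'a poly set) = CARD('a) ^ n"
proof (induction n)
  case 0
  have "polys_below 0 = {0 :: 'a poly}" by (auto simp: polys_below_iff)
  then show ?case by simp
next
  case (Suc n)
  have "polys_below (Suc n) = (\<lambda>(a, p). pCons a p) ` (UNIV \<times> (polys_below n :: 'a poly set))"
  proof (intro equalityI subsetI)
    fix p :: "'a poly"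
    assume p: "p \<in> polys_below (Suc n)"
    obtain a r where r: "p = pCons a r" by (cases p)
    have "coeff r i = 0" if "i \<ge> n" for i
      using p that r by (auto simp: polys_below_def dest: spec[of _ "Suc i"])
    then show "p \<in> (\<lambda>(a, p). pCons a p) ` (UNIV \<times> polys_below n)"
      using r by (auto simp: polys_below_def)
  next
    fix p :: "'a poly"
    assume "p \<in> (\<lambda>(a, p). pCons a p) ` (UNIV \<times> polys_below n)"
    then show "p \<in> polys_below (Suc n)"
      by (auto simp: polys_below_def coeff_pCons split: nat.splits)
  qed
  moreover have "inj_on (\<lambda>(a, p). pCons a p) (UNIV \<times> (polys_below n :: 'a poly set))"
    by (auto simp: inj_on_def)
  ultimately show ?case using Suc
    by (simp add: card_image card_cartesian_product)
qed

lemmas finite_polys_below = card_polys_below[THEN conjunct1]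

lemma mod_in_polys_below:
  fixes M :: "'a::field poly"
  assumes "M \<noteq> 0"
  shows "A mod M \<in> polys_below (degree M)"
  using degree_mod_less[OF assms, of A] by (simp add: polys_below_iff)

lemma mod_polys_below:
  fixes M :: "'a::field poly"
  assumes "A \<in> polys_below (degree M)"
  shows "A mod M = A"
  using assms by (auto simp: polys_below_iff mod_poly_less)

lemma add_polys_below: 
  "A \<in> polys_below n \<Longrightarrow> B \<in> polys_below n \<Longrightarrow> A + B \<in> polys_below n"
  "A \<in> polys_below n \<Longrightarrow> B \<in> polys_below n \<Longrightarrow> A - B \<in> polys_below n"
  for A :: "'a::ab_group_add poly"
  by (auto simp: polys_below_def)

text \<open>Moves a sum over an arbitrary residue system to the remainders, for summands that depend
  only on the class of \<open>D\<close>.\<close>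

lemma bij_betw_complete_residue_system:
  fixes M :: "'a::{field,finite} poly"
  assumes "complete_residue_system M R" "M \<noteq> 0"
  shows "bij_betw (\<lambda>D. D mod M) R (polys_below (degree M))"
proof (rule bij_betwI')
  fix D D' assume D: "D \<in> R" "D' \<in> R"
  have "\<exists>!D''. D'' \<in> R \<and> [D = D''] (mod M)"
    using assms(1) by (auto simp: complete_residue_system_def)
  then show "(D mod M = D' mod M) = (D = D')" using D unfolding cong_def by metis
next
  fix D show "D mod M \<in> polys_below (degree M)" using mod_in_polys_below[OF assms(2)] .
next
  fix A :: "'a poly" assume A: "A \<in> polys_below (degree M)"
  obtain D where "D \<in> R" "[A = D] (mod M)"
    using assms(1) unfolding complete_residue_system_def by blast
  then show "\<exists>D\<in>R. A = D mod M" using mod_polys_below[OF A] by (metis cong_def)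
qed

text \<open>Division by \<open>L\<close> maps these multiples bijectively onto
  \<open>polys_below (n - degree L)\<close>. If \<open>degree L = n\<close>, only 0 is left, in
  agreement with the exponent 0.\<close>

lemma card_polys_below_multiples:
  fixes L :: "'a::{field,finite} poly"
  assumes "L \<noteq> 0" "degree L \<le> n"
  shows "card {D \<in> polys_below n. L dvd D} = CARD('a) ^ (n - degree L)"
proof -
  have "L * B \<in> polys_below n \<longleftrightarrow> B \<in> polys_below (n - degree L)" for B
    using assms by (cases "B = 0") (auto simp: polys_below_iff degree_mult_eq)
  then have "{D \<in> polys_below n. L dvd D} = (*) L ` polys_below (n - degree L)"
    by (auto elim!: dvdE)
  moreover have "inj_on ((*) L) (polys_below (n - degree L))"
    using assms by (auto simp: inj_on_def)
  ultimately show ?thesis by (simp add: card_image card_polys_below)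
qed

section \<open>Additive characters and orthogonality\<close>

lemma t_coeff_add: "t_coeff M (A + B) = t_coeff M A + t_coeff M B"
  by (simp add: t_coeff_def poly_mod_add_left)

lemma t_coeff_mod: "t_coeff M (G * (A mod M)) = t_coeff M (G * A)"
  by (simp add: t_coeff_def mod_mult_right_eq)

lemma t_coeff_dvd: "M dvd A \<Longrightarrow> t_coeff M A = 0"
  by (simp add: t_coeff_def dvd_imp_mod_0)

text \<open>Nondegeneracy of the pairing of \<open>B\<close> with \<open>D\<close>. A suitable
  monomial \<open>D\<close> shifts the leading term of \<open>B mod M\<close> to degree
  \<open>degree M - 1\<close>; the product stays below \<open>degree M\<close>, so no reduction
  disturbs that coefficient.\<close>

lemma t_coeff_surj:
  assumes "M \<noteq> 0" "\<not> M dvd B"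
  shows "\<exists>D. t_coeff M (B * D) = c"
proof -
  define r where "r = B mod M"
  have r: "r \<noteq> 0" "degree r < degree M"
    using assms degree_mod_less[OF assms(1), of B] by (auto simp: r_def mod_eq_0_iff_dvd)
  define D where "D = monom (c / lead_coeff r) (degree M - 1 - degree r)"
  have "coeff (r * D) i = 0" if "i \<ge> degree M" for i
    using that r by (auto simp: D_def mult.commute[of r] coeff_monom_mult coeff_eq_0)
  then have "r * D \<in> polys_below (degree M)" by (simp add: polys_below_def)
  then have "(B * D) mod M = r * D"
    by (metis mod_mult_left_eq mod_polys_below r_def)
  moreover have "coeff (r * D) (degree M - 1) = c"
    using r by (simp add: D_def mult.commute[of r] coeff_monom_mult)
  ultimately have "t_coeff M (B * D) = c" using r by (simp add: t_coeff_def)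
  then show ?thesis ..
qed

lemma E_char_mod: "E_char lam G M (D mod M) = E_char lam G M D"
  by (simp add: E_char_def t_coeff_mod)

text \<open>The multiples of \<open>L\<close> below \<open>degree M\<close> form a finite additive
  group, and \<open>E_char lam G M\<close> is a character on it, trivial if
  \<open>M dvd G * L\<close>. Otherwise, translation by an element \<open>D0\<close> of value other
  than 1 multiplies the sum by that value and also preserves it.\<close>

lemma sum_E_char_multiples:
  fixes lam :: "'a::{field,finite} \<Rightarrow> complex"
  assumes lam: "nontrivial_additive_character lam" and M: "M \<noteq> 0" and L: "L dvd M"
  shows "(\<Sum>D | D \<in> polys_below (degree M) \<and> L dvd D. E_char lam G M D) =
    (if M dvd G * L then of_nat (CARD('a) ^ (degree M - degree L)) else 0)"
proof (cases "M dvd G * L")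
  case True
  have lam0: "lam 0 = 1"
    using lam unfolding nontrivial_additive_character_def
    by (metis add_0 mult_cancel_right1)
  have "E_char lam G M D = 1" if "L dvd D" for D
  proof -
    have "M dvd G * D" using True that by (meson dvd_refl dvd_trans mult_dvd_mono)
    then show ?thesis by (simp add: E_char_def t_coeff_dvd lam0)
  qed
  moreover have "L \<noteq> 0" "degree L \<le> degree M" using L M by (auto dest: dvd_imp_degree_le)
  ultimately show ?thesis
    using True card_polys_below_multiples[of L "degree M"] by simp
next
  case False
  define T where "T = {D \<in> polys_below (degree M). L dvd D}"
  obtain c where c: "lam c \<noteq> 1" using lam by (auto simp: nontrivial_additive_character_def)
  obtain B where B: "t_coeff M (G * L * B) = c" using t_coeff_surj[OF M False] by blast
  \<comment> \<open>Since \<open>L dvd M\<close>, reduction modulo \<open>M\<close> leaves a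
    multiple of \<open>L\<close>.\<close>
  define D0 where "D0 = (L * B) mod M"
  have E0: "E_char lam G M D0 \<noteq> 1"
    using B c by (simp add: D0_def E_char_mod) (simp add: E_char_def mult.assoc)
  have D0: "D0 \<in> polys_below (degree M)" "L dvd D0"
    using L by (simp_all add: D0_def mod_in_polys_below[OF M] dvd_mod)
  have mult: "E_char lam G M (D + D0) = E_char lam G M D * E_char lam G M D0" for D
    using lam by (simp add: E_char_def distrib_left t_coeff_add nontrivial_additive_character_def)
  have "sum (E_char lam G M) T = (\<Sum>D\<in>T. E_char lam G M (D + D0))"
    by (rule sum.reindex_bij_witness[of _ "\<lambda>D. D + D0" "\<lambda>D. D - D0"])
      (use D0 in \<open>auto simp: T_def add_polys_below\<close>)
  also have "\<dots> = sum (E_char lam G M) T * E_char lam G M D0"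
    by (simp add: mult sum_distrib_right)
  finally have "sum (E_char lam G M) T = 0" using E0 by simp
  then show ?thesis using False by (simp add: T_def)
qed

section \<open>The largest common \<open>k\<close>-th power\<close>

lemma kgcd_monic_common_kth_power:
  assumes "A \<noteq> 0 \<or> B \<noteq> 0"
  shows "monic_common_kth_power k A B (kgcd k A B)"
    and "monic_common_kth_power k A B D \<Longrightarrow> degree D \<le> degree (kgcd k A B)"
  using theI'[OF kgcd_unique[OF assms, of k]] unfolding kgcd_def by blast+

text \<open>Upgrades maximality of degree to divisibility: the \<open>k\<close>-th power of a least
  common multiple of \<open>C\<close> and \<open>U\<close> is again a common divisor, so that
  multiple has no larger degree than \<open>U\<close>, and \<open>C\<close> contributes nothing
  new.\<close>

lemma dvd_kgcd_root:
  fixes A B C U :: "'a::{field,finite} poly"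
  assumes k: "k \<ge> 1" and nz: "A \<noteq> 0 \<or> B \<noteq> 0"
    and U: "U ^ k = kgcd k A B" and C: "C ^ k dvd A" "C ^ k dvd B"
  shows "C dvd U"
proof -
  have Uk: "lead_coeff (U ^ k) = 1" "U ^ k dvd A" "U ^ k dvd B"
    using kgcd_monic_common_kth_power(1)[OF nz, of k] U by (auto simp: monic_common_kth_power_def)
  have U0: "U \<noteq> 0" using Uk(1) k by (auto simp: zero_power)
  have C0: "C \<noteq> 0" using C nz k by (auto simp: zero_power)
  obtain g c u x y where *: "g \<noteq> 0" "C = g * c" "U = g * u" "x * c + y * u = 1"
    using poly_bezout_cofactors[of C U] C0 by metis
  from comaximal_powers[OF *(4)] obtain x y where xy: "x * c ^ k + y * u ^ k = 1" by blast
  define L where "L = g * c * u"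
  have L0: "L \<noteq> 0" using U0 C0 * by (simp add: L_def)
  have Ldvd: "L ^ k dvd F" if F: "C ^ k dvd F" "U ^ k dvd F" for F
  proof -
    from F(1) *(2) have "g ^ k dvd F" by (metis dvd_mult_left power_mult_distrib)
    then obtain f where f: "F = g ^ k * f" by auto
    have "c ^ k dvd f" "u ^ k dvd f"
      using F *(1) unfolding *(2,3) f by (simp_all add: power_mult_distrib)
    then have "c ^ k * u ^ k dvd f" by (rule comaximal_mult_dvd[OF xy])
    then show ?thesis by (simp add: L_def f power_mult_distrib mult.assoc)
  qed
  \<comment> \<open>Candidates for \<open>kgcd\<close> must be monic.\<close>
  define K where "K = smult (inverse (lead_coeff L)) L"
  have "lead_coeff (K ^ k) = 1" using L0 by (simp add: K_def lead_coeff_power)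
  moreover have "K ^ k dvd A" "K ^ k dvd B"
    using Ldvd C Uk L0 by (simp_all add: K_def smult_power smult_dvd_iff)
  ultimately have "monic_common_kth_power k A B (K ^ k)"
    by (auto simp: monic_common_kth_power_def)
  from kgcd_monic_common_kth_power(2)[OF nz this] have "degree (K ^ k) \<le> degree (U ^ k)"
    by (simp add: U)
  then have "degree L \<le> degree U" using k L0 U0 by (simp add: K_def degree_power_eq)
  moreover have "L = U * c" by (simp add: L_def *(3) mult_ac)
  ultimately have "degree c = 0" using L0 by (simp add: degree_mult_eq)
  moreover have "c \<noteq> 0" using C0 * by auto
  ultimately have "c dvd 1" by (simp add: is_unit_iff_degree)
  then have "c dvd u" by (rule dvd_trans) simp
  then show ?thesis unfolding *(2,3) by (rule mult_dvd_mono[OF dvd_refl])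
qed

text \<open>If the \<open>k\<close>-th root of the \<open>kgcd\<close> is not a unit, it has a monic
  irreducible factor \<open>P\<close>, which divides \<open>H\<close> as well. Conversely, a
  \<open>P ^ k\<close> dividing \<open>D\<close> would force \<open>P\<close> to divide the root
  1.\<close>

lemma kgcd_eq_1_iff:
  fixes D H :: "'a::{field,finite} poly"
  assumes k: "k \<ge> 1" and H: "H \<noteq> 0"
  shows "kgcd k D (H ^ k) = 1 \<longleftrightarrow> (\<forall>P\<in>monic_irreducible_factors H. \<not> P ^ k dvd D)"
proof
  assume g: "kgcd k D (H ^ k) = 1"
  show "\<forall>P\<in>monic_irreducible_factors H. \<not> P ^ k dvd D"
  proof (intro ballI notI)
    fix P assume P: "P \<in> monic_irreducible_factors H" "P ^ k dvd D"
    then have "P ^ k dvd H ^ k" by (auto simp: monic_irreducible_factors_def dvd_power_same)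
    then have "P dvd 1"
      using dvd_kgcd_root[of k D "H ^ k" 1 P] k H g P(2) by simp
    then show False using P(1) by (auto simp: monic_irreducible_factors_def irreducible_def)
  qed
next
  assume no: "\<forall>P\<in>monic_irreducible_factors H. \<not> P ^ k dvd D"
  have nz: "D \<noteq> 0 \<or> H ^ k \<noteq> 0" using H by simp
  obtain C where C: "kgcd k D (H ^ k) = C ^ k" "lead_coeff (C ^ k) = 1" "C ^ k dvd D" "C ^ k dvd H ^ k"
    using kgcd_monic_common_kth_power(1)[OF nz, of k] by (auto simp: monic_common_kth_power_def)
  have C0: "C \<noteq> 0" using C(2) k by (auto simp: zero_power)
  have "C dvd 1"
  proof (rule ccontr)
    assume "\<not> C dvd 1"
    then obtain P where P: "lead_coeff P = 1" "irreducible P" "P dvd C"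
      using exists_monic_irreducible_factor[OF C0] by blast
    have "P ^ k dvd D" using dvd_power_same[OF P(3)] C(3) dvd_trans by blast
    moreover have "P dvd H"
      using P(3) poly_power_dvd_power_imp_dvd[OF C(4) k] dvd_trans by blast
    ultimately show False using no P by (auto simp: monic_irreducible_factors_def)
  qed
  then have "C ^ k dvd 1" by (metis dvd_power_same power_one)
  then have "C ^ k = 1"
    using monic_dvd_same_degree[of "C ^ k" 1] C(2) by simp
  then show "kgcd k D (H ^ k) = 1" using C(1) by simp
qed

section \<open>Squarefree polynomials and norms\<close>

lemma finite_monic_irreducible_factors:
  fixes H :: "'a::{field,finite} poly"
  assumes "H \<noteq> 0"
  shows "finite (monic_irreducible_factors H)"
proof (rule finite_subset)
  show "monic_irreducible_factors H \<subseteq> polys_below (Suc (degree H))"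
    using assms
    by (auto simp: monic_irreducible_factors_def polys_below_iff less_Suc_eq_le dest!: dvd_imp_degree_le)
qed (rule finite_polys_below)

text \<open>An irreducible factor of the cofactor \<open>r\<close> would also occur in the product,
  so its square would divide \<open>N\<close>. Hence \<open>r\<close> is a unit; it need not be 1,
  as \<open>N\<close> need not be monic.\<close>

lemma squarefree_prod_monic_irreducible_factors:
  fixes N :: "'a::{field,finite} poly"
  assumes N: "N \<noteq> 0" and sf: "\<And>P. irreducible P \<Longrightarrow> \<not> P\<^sup>2 dvd N"
  shows "N dvd \<Prod>(monic_irreducible_factors N)" "\<Prod>(monic_irreducible_factors N) dvd N"
proof -
  define F where "F = monic_irreducible_factors N"
  have F: "finite F" "\<And>Q. Q \<in> F \<Longrightarrow> lead_coeff Q = 1 \<and> irreducible Q"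
    using finite_monic_irreducible_factors[OF N] by (auto simp: F_def monic_irreducible_factors_def)
  have d: "\<Prod>F dvd N"
    using prod_power_dvd_iff[OF F, where k = 1 and D = N]
    by (auto simp: F_def monic_irreducible_factors_def)
  then obtain r where r: "N = \<Prod>F * r" by auto
  have "r dvd 1"
  proof (rule ccontr)
    assume "\<not> r dvd 1"
    then obtain P where P: "lead_coeff P = 1" "irreducible P" "P dvd r"
      using exists_monic_irreducible_factor[of r] r N by auto
    then have "P dvd N" using r by (metis dvd_mult)
    then have "P \<in> F" using P by (simp add: F_def monic_irreducible_factors_def)
    then have "P dvd \<Prod>F" using F(1) by (auto intro: dvd_prod_eqI)
    then have "P\<^sup>2 dvd N" using P(3) by (simp add: r power2_eq_square mult_dvd_mono)
    then show False using sf P by blast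
  qed
  then have "\<Prod>F * r dvd \<Prod>F" by (simp add: mult_unit_dvd_iff)
  then have "N dvd \<Prod>F" by (simp only: r[symmetric])
  with d show "N dvd \<Prod>(monic_irreducible_factors N)" "\<Prod>(monic_irreducible_factors N) dvd N"
    by (simp_all only: F_def)
qed

lemma pnorm_mult: "A \<noteq> 0 \<Longrightarrow> B \<noteq> 0 \<Longrightarrow> pnorm (A * B) = pnorm A * pnorm B"
  by (simp add: pnorm_def degree_mult_eq power_add)

lemma pnorm_prod:
  "finite S \<Longrightarrow> (\<And>P. P \<in> S \<Longrightarrow> P \<noteq> 0) \<Longrightarrow> pnorm (\<Prod>S) = (\<Prod>P\<in>S. pnorm P)"
  by (induction S rule: finite_induct) (auto simp: pnorm_mult, simp add: pnorm_def)

text \<open>Strictness keeps the Euler factors \<open>1 - 1 / pnorm P ^ k\<close> away from 0, so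
  that \<open>jordan_phi k N\<close> can be inverted.\<close>

lemma pnorm_irreducible_gt_1:
  fixes P :: "'a::{field,finite} poly"
  assumes "irreducible P"
  shows "pnorm P > 1"
proof -
  have "degree P \<noteq> 0" using assms by (metis irreducible_def is_unit_iff_degree)
  moreover have "CARD('a) > 1"
    using card_mono[of UNIV "{0, 1 :: 'a}"] by simp
  ultimately show ?thesis by (simp add: pnorm_def one_less_power)
qed

section \<open>Inclusion-exclusion for \<open>eta\<close>\<close>

lemma eta_eq_sum_Pow:
  fixes lam :: "'a::{field,finite} \<Rightarrow> complex"
  assumes lam: "nontrivial_additive_character lam" and k: "k \<ge> 1" and H: "H \<noteq> 0"
    and R: "complete_residue_system (H ^ k) R"
  shows "eta lam k R G H = complex_of_real (pnorm H ^ k *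
    (\<Sum>S | S \<subseteq> monic_irreducible_factors H \<and> H ^ k dvd G * (\<Prod>S) ^ k.
       \<Prod>P\<in>S. - 1 / pnorm P ^ k))"
proof -
  define M where "M = H ^ k"
  define F where "F = monic_irreducible_factors H"
  define C :: "'a poly set" where "C = polys_below (degree M)"
  let ?E = "E_char lam G M"
  have M0: "M \<noteq> 0" using H by (simp add: M_def)
  have F: "finite F" "\<And>Q. Q \<in> F \<Longrightarrow> lead_coeff Q = 1 \<and> irreducible Q"
    using finite_monic_irreducible_factors[OF H] by (auto simp: F_def monic_irreducible_factors_def)
  have F0: "P \<noteq> 0" if "P \<in> F" for P using F(2)[OF that] by auto
  have bij: "bij_betw (\<lambda>D. D mod M) R C"
    using bij_betw_complete_residue_system[OF R[folded M_def] M0] by (simp add: C_def)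
  have finC: "finite C" by (simp add: C_def finite_polys_below)
  then have finR: "finite R" using bij_betw_finite[OF bij] by simp
  \<comment> \<open>Extension by zero makes the restricted sum one over a full residue system. As
    every \<open>P ^ k\<close> divides \<open>M\<close>, the restriction depends only on
    \<open>D mod M\<close>.\<close>
  define f where "f = (\<lambda>D. if \<forall>P\<in>F. \<not> P ^ k dvd D then ?E D else 0)"
  have PM: "P ^ k dvd M" if "P \<in> F" for P
    using that by (auto simp: F_def monic_irreducible_factors_def M_def dvd_power_same)
  have fmod: "f (D mod M) = f D" for D
    using PM by (auto simp: f_def E_char_mod dvd_mod_iff)
  have prodM: "(\<Prod>S) ^ k dvd M" if "S \<subseteq> F" for S
    using that prod_power_dvd_iff[of S k M] F PM finite_subset[OF that F(1)] by blast
  \<comment> \<open>Expansion of the product over \<open>P\<close> in \<open>F\<close> of 1 minus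
    the indicator of \<open>P ^ k dvd D\<close>.\<close>
  have ind: "(if \<forall>P\<in>F. \<not> P ^ k dvd D then 1 else 0 :: complex) =
    (\<Sum>S\<in>Pow F. (-1) ^ card S * (if (\<Prod>S) ^ k dvd D then 1 else 0))" for D
  proof -
    have *: "(\<Prod>P\<in>S. if P ^ k dvd D then 1 else 0 :: complex) = (if (\<Prod>S) ^ k dvd D then 1 else 0)"
      if S: "S \<subseteq> F" for S
    proof -
      have "finite S" using S F(1) finite_subset by blast
      moreover have "(\<Prod>S) ^ k dvd D \<longleftrightarrow> (\<forall>P\<in>S. P ^ k dvd D)"
        using prod_power_dvd_iff[of S k D] S F \<open>finite S\<close> by blast
      ultimately show ?thesis by (auto simp: prod_zero_iff intro!: prod.neutral)
    qed
    have "(if \<forall>P\<in>F. \<not> P ^ k dvd D then 1 else 0 :: complex) =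
      (\<Prod>P\<in>F. 1 - (if P ^ k dvd D then 1 else 0))"
      using F(1) by (auto intro!: prod.neutral[symmetric])
    also have "\<dots> = (\<Sum>S\<in>Pow F. (-1) ^ card S * (\<Prod>P\<in>S. if P ^ k dvd D then 1 else 0))"
      by (subst prod_diff_conv_sum[OF F(1)]) simp
    also have "\<dots> = (\<Sum>S\<in>Pow F. (-1) ^ card S * (if (\<Prod>S) ^ k dvd D then 1 else 0))"
      by (intro sum.cong) (simp_all add: *)
    finally show ?thesis .
  qed
  have summand: "(-1) ^ card S * (\<Sum>D | D \<in> C \<and> (\<Prod>S) ^ k dvd D. ?E D) =
     (if M dvd G * (\<Prod>S) ^ k
      then complex_of_real (pnorm H ^ k * (\<Prod>P\<in>S. - 1 / pnorm P ^ k)) else 0)" if S: "S \<subseteq> F" for S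
  proof -
    have finS: "finite S" using S F(1) finite_subset by blast
    have q: "real CARD('a) > 0" by simp
    have Q0: "(\<Prod>S) \<noteq> 0" using F0 S finS by auto
    have deg: "degree ((\<Prod>S) ^ k) \<le> degree M" using prodM[OF S] M0 by (rule dvd_imp_degree_le)
    have "real CARD('a) ^ (degree M - degree ((\<Prod>S) ^ k)) = pnorm H ^ k / pnorm (\<Prod>S) ^ k"
      using deg q H Q0
      by (subst power_diff) (auto simp: pnorm_def M_def degree_power_eq simp flip: power_mult, simp add: mult.commute)
    also have "pnorm (\<Prod>S) = (\<Prod>P\<in>S. pnorm P)"
      using F0 S finS by (intro pnorm_prod) auto
    \<comment> \<open>The sign and the norm are spread over the members of \<open>S\<close>, so that
      the term becomes multiplicative in \<open>S\<close>.\<close>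
    finally have "(-1) ^ card S * real (CARD('a) ^ (degree M - degree ((\<Prod>S) ^ k))) =
      pnorm H ^ k * (\<Prod>P\<in>S. - 1 / pnorm P ^ k)"
      by (simp add: prod_uminus prod_dividef prod_power_distrib)
    then have "complex_of_real ((-1) ^ card S * real (CARD('a) ^ (degree M - degree ((\<Prod>S) ^ k)))) =
      complex_of_real (pnorm H ^ k * (\<Prod>P\<in>S. - 1 / pnorm P ^ k))" by simp
    then show ?thesis
      using sum_E_char_multiples[OF lam M0 prodM[OF S], of G] by (simp add: C_def)
  qed
  have "eta lam k R G H = sum f R"
    unfolding eta_def f_def F_def M_def kgcd_eq_1_iff[OF k H]
    using finR by (simp add: sum.inter_filter)
  also have "\<dots> = sum f C"
    using sum.reindex_bij_betw[OF bij, of f] by (simp add: fmod)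
  also have "\<dots> = (\<Sum>D\<in>C. (if \<forall>P\<in>F. \<not> P ^ k dvd D then 1 else 0) * ?E D)"
    unfolding f_def by (intro sum.cong) auto
  also have "\<dots> = (\<Sum>D\<in>C. \<Sum>S\<in>Pow F. (-1) ^ card S * (if (\<Prod>S) ^ k dvd D then ?E D else 0))"
    unfolding ind sum_distrib_right by (intro sum.cong) auto
  also have "\<dots> = (\<Sum>S\<in>Pow F. (-1) ^ card S * (\<Sum>D | D \<in> C \<and> (\<Prod>S) ^ k dvd D. ?E D))"
    unfolding sum.inter_filter[OF finC] sum_distrib_left by (rule sum.swap)
  also have "\<dots> = (\<Sum>S\<in>Pow F. if M dvd G * (\<Prod>S) ^ k
      then complex_of_real (pnorm H ^ k * (\<Prod>P\<in>S. - 1 / pnorm P ^ k)) else 0)"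
    by (intro sum.cong refl summand) auto
  also have "\<dots> = (\<Sum>S | S \<in> Pow F \<and> M dvd G * (\<Prod>S) ^ k.
      complex_of_real (pnorm H ^ k * (\<Prod>P\<in>S. - 1 / pnorm P ^ k)))"
    using F(1) by (subst sum.inter_filter) auto
  finally show ?thesis
    by (simp add: F_def M_def sum_distrib_left)
qed

section \<open>Euler products and evaluation of \<open>eta\<close>\<close>

lemma sum_prod_supersets:
  fixes g :: "'b \<Rightarrow> 'c::comm_ring_1"
  assumes "finite F" "F' \<subseteq> F"
  shows "(\<Sum>S | S \<subseteq> F \<and> F' \<subseteq> S. \<Prod>x\<in>S. g x) = (\<Prod>x\<in>F'. g x) * (\<Prod>x\<in>F - F'. 1 + g x)"
proof -
  have fin: "finite F'" using assms finite_subset by blast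
  \<comment> \<open>A superset \<open>S\<close> is determined by its part \<open>T\<close> outside
    \<open>F'\<close>; summing over all \<open>T\<close> then expands a product of factors
    \<open>g x + 1\<close>.\<close>
  have "(\<Sum>S | S \<subseteq> F \<and> F' \<subseteq> S. \<Prod>x\<in>S. g x) = (\<Sum>T\<in>Pow (F - F'). \<Prod>x\<in>F' \<union> T. g x)"
    by (rule sum.reindex_bij_witness[of _ "\<lambda>T. F' \<union> T" "\<lambda>S. S - F'"])
      (use assms(2) in \<open>auto simp: Un_absorb1\<close>)
  also have "\<dots> = (\<Sum>T\<in>Pow (F - F'). (\<Prod>x\<in>F'. g x) * (\<Prod>x\<in>T. g x))"
  proof (rule sum.cong)
    fix T assume "T \<in> Pow (F - F')"
    moreover from this have "finite T" using assms(1) by (auto intro: finite_subset)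
    ultimately show "(\<Prod>x\<in>F' \<union> T. g x) = (\<Prod>x\<in>F'. g x) * (\<Prod>x\<in>T. g x)"
      using fin by (intro prod.union_disjoint) auto
  qed simp
  also have "\<dots> = (\<Prod>x\<in>F'. g x) * (\<Prod>x\<in>F - F'. g x + 1)"
    using assms(1) by (simp add: prod_add sum_distrib_left)
  finally show ?thesis by (simp add: add.commute)
qed

theorem theorem2p1:
  fixes lam :: "'a::{field,finite} \<Rightarrow> complex"
    and k :: nat
    and G H A N :: "'a poly"
    and R :: "'a poly set"
  assumes "nontrivial_additive_character lam"
    and "k \<ge> 1"
    and "H \<noteq> 0"
    and "complete_residue_system (H ^ k) R"
    and "lead_coeff A = 1"
    and "A ^ k = kgcd k G (H ^ k)"
    and "N = H div A"
  shows "eta lam k R G H =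
    complex_of_real (jordan_phi k H) * of_int (poly_mu N) * inverse (complex_of_real (jordan_phi k N))"
proof -
  define F where "F = monic_irreducible_factors H"
  define F' where "F' = monic_irreducible_factors N"
  define g where "g = (\<lambda>P :: 'a poly. - 1 / pnorm P ^ k)"
  have nz: "G \<noteq> 0 \<or> H ^ k \<noteq> 0" using assms(3) by simp
  have Ak: "A ^ k dvd G" "A ^ k dvd H ^ k"
    using kgcd_monic_common_kth_power(1)[OF nz, of k] assms(6)
    by (auto simp: monic_common_kth_power_def)
  have AH: "A dvd H" using poly_power_dvd_power_imp_dvd[OF Ak(2) assms(2)] .
  then have H_eq: "H = A * N" using assms(7) by simp
  have N0: "N \<noteq> 0" using assms(3) H_eq by auto
  have F: "finite F" "\<And>Q. Q \<in> F \<Longrightarrow> lead_coeff Q = 1 \<and> irreducible Q"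
    using finite_monic_irreducible_factors[OF assms(3)]
    by (auto simp: F_def monic_irreducible_factors_def)
  have F'F: "F' \<subseteq> F" using H_eq by (auto simp: F_def F'_def monic_irreducible_factors_def)
  have F': "finite F'" "\<And>Q. Q \<in> F' \<Longrightarrow> lead_coeff Q = 1 \<and> irreducible Q"
    using F F'F finite_subset by auto
  \<comment> \<open>With \<open>B\<close> the cofactor of the product in \<open>H\<close>, the
    condition is \<open>B ^ k dvd G\<close>, that is \<open>B dvd A\<close> by
    \<open>dvd_kgcd_root\<close>. Multiplying by \<open>N\<close> and comparing the two
    factorizations of \<open>H\<close> turns this into \<open>N dvd \<Prod>S\<close>.\<close>
  have dvd_iff: "H ^ k dvd G * (\<Prod>S) ^ k \<longleftrightarrow> N dvd \<Prod>S" if S: "S \<subseteq> F" for S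
  proof -
    have finS: "finite S" using S F(1) finite_subset by blast
    have "\<Prod>S dvd H"
    proof -
      have "P dvd H" if "P \<in> S" for P
        using that S by (auto simp: F_def monic_irreducible_factors_def)
      moreover have "lead_coeff P = 1 \<and> irreducible P" if "P \<in> S" for P
        using that S F(2) by blast
      ultimately show ?thesis using prod_power_dvd_iff[OF finS, where k = 1 and D = H] by simp
    qed
    then obtain B where B: "H = \<Prod>S * B" by (rule dvdE)
    have B0: "B \<noteq> 0" and S0: "\<Prod>S \<noteq> 0" using B assms(3) by force+
    have "H ^ k dvd G * (\<Prod>S) ^ k \<longleftrightarrow> (\<Prod>S) ^ k * B ^ k dvd (\<Prod>S) ^ k * G"
      by (simp add: B power_mult_distrib mult.commute)
    also have "\<dots> \<longleftrightarrow> B ^ k dvd G" using S0 by simp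
    also have "\<dots> \<longleftrightarrow> B dvd A"
    proof
      assume "B ^ k dvd G"
      moreover have "B ^ k dvd H ^ k" using B by (simp add: dvd_power_same)
      ultimately show "B dvd A" using dvd_kgcd_root[OF assms(2) nz assms(6)] by blast
    next
      assume "B dvd A"
      then show "B ^ k dvd G" using Ak(1) dvd_power_same dvd_trans by blast
    qed
    also have "\<dots> \<longleftrightarrow> B * N dvd A * N" using N0 by simp
    also have "\<dots> \<longleftrightarrow> B * N dvd B * \<Prod>S" using B H_eq by (simp add: mult.commute)
    also have "\<dots> \<longleftrightarrow> N dvd \<Prod>S" using B0 by simp
    finally show ?thesis .
  qed
  have sets: "{S. S \<subseteq> F \<and> H ^ k dvd G * (\<Prod>S) ^ k} = {S. S \<subseteq> F \<and> N dvd \<Prod>S}"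
    using dvd_iff by auto
  have eta: "eta lam k R G H =
    complex_of_real (pnorm H ^ k * (\<Sum>S | S \<subseteq> F \<and> N dvd \<Prod>S. \<Prod>P\<in>S. g P))"
    using eta_eq_sum_Pow[OF assms(1-4), of G] sets by (simp add: F_def g_def)
  show ?thesis
  proof (cases "\<exists>P. irreducible P \<and> P\<^sup>2 dvd N")
    case True
    then obtain P where P: "irreducible P" "P\<^sup>2 dvd N" by blast
    \<comment> \<open>Products of distinct irreducibles are squarefree, so the sum is empty.\<close>
    have "\<not> N dvd \<Prod>S" if S: "S \<subseteq> F" for S
      using square_not_dvd_prod[of S P] P F S finite_subset[OF S F(1)] dvd_trans by blast
    then have "{S. S \<subseteq> F \<and> N dvd \<Prod>S} = {}" by blast
    then have "eta lam k R G H = 0" unfolding eta by (simp only: sum.empty) simp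
    moreover have "poly_mu N = 0" using True by (auto simp: poly_mu_def)
    ultimately show ?thesis by simp
  next
    case False
    then have mu: "poly_mu N = (-1) ^ card F'" using N0 by (auto simp: poly_mu_def F'_def)
    have N: "N dvd \<Prod>F'" "\<Prod>F' dvd N"
      using squarefree_prod_monic_irreducible_factors[OF N0] False by (auto simp: F'_def)
    have "N dvd \<Prod>S \<longleftrightarrow> F' \<subseteq> S" if S: "S \<subseteq> F" for S
    proof
      have finS: "finite S" using S F(1) finite_subset by blast
      {
        assume "N dvd \<Prod>S"
        then have "P dvd \<Prod>S" if "P \<in> F'" for P
          using that dvd_trans by (auto simp: F'_def monic_irreducible_factors_def)
        then show "F' \<subseteq> S"
          using monic_irreducible_dvd_prod_iff[of S] F F' finS S by blast
      next
        assume "F' \<subseteq> S"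
        then have "\<Prod>F' dvd \<Prod>S" using finS by (simp add: prod_dvd_prod_subset)
        then show "N dvd \<Prod>S" using N(1) dvd_trans by blast
      }
    qed
    then have "{S. S \<subseteq> F \<and> N dvd \<Prod>S} = {S. S \<subseteq> F \<and> F' \<subseteq> S}" by auto
    then have eta': "eta lam k R G H =
        complex_of_real (pnorm H ^ k * ((\<Prod>P\<in>F'. g P) * (\<Prod>P\<in>F - F'. 1 + g P)))"
      unfolding eta using sum_prod_supersets[OF F(1) F'F, of g] by simp
    \<comment> \<open>\<open>N\<close> and the product are only associates, but \<open>pnorm\<close>
      sees just the degree.\<close>
    have degN: "degree N = degree (\<Prod>F')"
      using N N0 F' by (intro antisym dvd_imp_degree_le) auto
    have "pnorm N = (\<Prod>P\<in>F'. pnorm P)"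
      using pnorm_prod[of F'] F' by (force simp: pnorm_def degN)
    then have "jordan_phi k N = (\<Prod>P\<in>F'. pnorm P ^ k) * (\<Prod>P\<in>F'. 1 + g P)"
      by (simp add: jordan_phi_def F'_def g_def prod_power_distrib)
    \<comment> \<open>The Euler factors over \<open>F'\<close> are split off because they cancel
      against those of \<open>jordan_phi k N\<close>; what remains is the product over
      \<open>F - F'\<close> in \<open>eta'\<close>.\<close>
    moreover have "jordan_phi k H = pnorm H ^ k * ((\<Prod>P\<in>F'. 1 + g P) * (\<Prod>P\<in>F - F'. 1 + g P))"
      using prod.subset_diff[OF F'F F(1), of "\<lambda>P. 1 + g P"]
      by (simp add: jordan_phi_def F_def g_def mult.commute)
    moreover have "(\<Prod>P\<in>F'. g P) = (-1) ^ card F' / (\<Prod>P\<in>F'. pnorm P ^ k)"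
      by (simp add: g_def prod_uminus prod_dividef)
    moreover have "(\<Prod>P\<in>F'. pnorm P ^ k) \<noteq> 0" "(\<Prod>P\<in>F'. 1 + g P) \<noteq> 0"
    proof -
      have gt: "pnorm P ^ k > 1" if "P \<in> F'" for P
        using pnorm_irreducible_gt_1[of P] F'(2)[OF that] assms(2) by (intro one_less_power) auto
      have "pnorm P ^ k \<noteq> 0 \<and> 1 + g P \<noteq> 0" if "P \<in> F'" for P
      proof -
        have "x \<noteq> 0 \<and> 1 + - 1 / x \<noteq> 0" if "x > 1" for x :: real
          using that by (auto simp: field_simps)
        from this[OF gt[OF that]] show ?thesis unfolding g_def .
      qed
      then show "(\<Prod>P\<in>F'. pnorm P ^ k) \<noteq> 0" "(\<Prod>P\<in>F'. 1 + g P) \<noteq> 0"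
        using F'(1) by (auto simp: prod_zero_iff)
    qed
    ultimately have "pnorm H ^ k * ((\<Prod>P\<in>F'. g P) * (\<Prod>P\<in>F - F'. 1 + g P)) =
        jordan_phi k H * (-1) ^ card F' * inverse (jordan_phi k N)"
      by (simp add: field_simps)
    then show ?thesis unfolding eta' mu by simp
  qed
qed

end
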